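(* Let $T\subset\mathbb{R}^3$ be a nondegenerate closed tetrahedron with vertices $x_1,x_2,x_3,x_4$, let $\varepsilon>0$ and let $\beta:T\to\mathbb{R}^3$ be a vector field. Then for every $x\in T$ the following linear system of four scalar equations (one for each $m\in\{1,2,3,4\}$) in the unknowns $(j,\phi)\in\mathbb{R}\times\mathbb{R}^3$ has a unique solution: $$|T_m|\,j+\Big(B_3^\varepsilon(\sigma_p,\sigma_q,\sigma_r)\tfrac{l_p\times l_q}{2}+B_3^\varepsilon(\sigma_q,\sigma_r,\sigma_p)\tfrac{l_q\times l_r}{2}+B_3^\varepsilon(\sigma_r,\sigma_p,\sigma_q)\tfrac{l_r\times l_p}{2}\Big)\cdot\phi=B_3^\varepsilon(\sigma_{pq},\sigma_{pr},-\sigma_p)\,\delta_{1m},$$ where, for each $m$, $(p,q,r)$ is an ordering of $\{1,2,3,4\}\setminus\{m\}$ such that $\big((x_q-x_p)\times(x_r-x_p)\big)\cdot n_m>0$.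
   Context: $F_m$ is the facet of $T$ opposite $x_m$ and $n_m$ its unit outward normal. For $x\in T$: $l_i:=x_i-x$, $\sigma_i:=\beta(x)\cdot l_i$, $\sigma_{ij}:=\beta(x)\cdot(x_j-x_i)$; $T_m$ is the (possibly degenerate) sub-tetrahedron with apex $x$ and base $F_m$, and $|T_m|\ge0$ its volume. The 3D-Bernoulli function $B_3^\varepsilon:\mathbb{R}^3\to(0,\infty)$ is $$B_3^\varepsilon(a,b,c):=\varepsilon\,\frac{2\int_0^1\int_0^{1-y_2}e^{(ay_1+by_2)/\varepsilon}\,dy_1dy_2}{6\int_0^1\int_0^{1-y_3}\int_0^{1-y_2-y_3}e^{(ay_1+by_2+cy_3)/\varepsilon}\,dy_1dy_2dy_3}.$$ It is symmetric in its first two arguments, and the equation for each $m$ does not depend on which admissible ordering $(p,q,r)$ is chosen. The unknowns $\phi$ and $j$ are the values at $x$ of the $H(\mathrm{div})$ exponentially-fitted basis function associated with the facet $F_1$ and of its discrete flux. *)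

theory Defs
  imports "HOL-Analysis.Analysis"
begin

definition bernoulli3 :: "real \<Rightarrow> real \<Rightarrow> real \<Rightarrow> real \<Rightarrow> real" where
  "bernoulli3 \<epsilon> a b c =
     \<epsilon> * ((2 * integral {0..1} (\<lambda>y2. integral {0..1 - y2} (\<lambda>y1. exp ((a * y1 + b * y2) / \<epsilon>)))) /
          (6 * integral {0..1} (\<lambda>y3. integral {0..1 - y3} (\<lambda>y2. integral {0..1 - y2 - y3}
             (\<lambda>y1. exp ((a * y1 + b * y2 + c * y3) / \<epsilon>))))))"

text \<open>The vertices of a tetrahedron are \<open>X 1, X 2, X 3, X 4\<close>; the values of \<open>X\<close> at other
  indices are irrelevant.\<close>

definition nondegenerate_tetrahedron :: "(nat \<Rightarrow> real^3) \<Rightarrow> bool" where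
  "nondegenerate_tetrahedron X \<longleftrightarrow> inj_on X {1..4} \<and> \<not> affine_dependent (X ` {1..4})"

definition tetrahedron :: "(nat \<Rightarrow> real^3) \<Rightarrow> (real^3) set" where
  "tetrahedron X = convex hull (X ` {1..4})"

definition opposite_facet :: "(nat \<Rightarrow> real^3) \<Rightarrow> nat \<Rightarrow> (real^3) set" where
  "opposite_facet X m = convex hull (X ` ({1..4} - {m}))"

definition sub_tetrahedron :: "(nat \<Rightarrow> real^3) \<Rightarrow> real^3 \<Rightarrow> nat \<Rightarrow> (real^3) set" where
  "sub_tetrahedron X x m = convex hull (insert x (opposite_facet X m))"

definition outward_unit_normal :: "(real^3) set \<Rightarrow> (real^3) set \<Rightarrow> real^3 \<Rightarrow> bool" where
  "outward_unit_normal T F n \<longleftrightarrow>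
     norm n = 1 \<and> (\<forall>y\<in>F. \<forall>z\<in>F. n \<bullet> (z - y) = 0) \<and> (\<forall>y\<in>F. \<forall>z\<in>T. n \<bullet> (z - y) \<le> 0)"

text \<open>An ordering \<open>(p, q, r)\<close> of the vertex indices of the facet opposite \<open>X m\<close>, oriented along
  the outward normal \<open>n\<close>. The set equation forces \<open>p\<close>, \<open>q\<close>, \<open>r\<close> to be distinct.\<close>

definition admissible_ordering ::
  "(nat \<Rightarrow> real^3) \<Rightarrow> real^3 \<Rightarrow> nat \<Rightarrow> nat \<Rightarrow> nat \<Rightarrow> nat \<Rightarrow> bool" where
  "admissible_ordering X n m p q r \<longleftrightarrow>
     {p, q, r} = {1..4} - {m} \<and> cross3 (X q - X p) (X r - X p) \<bullet> n > 0"

end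

theory Submission
  imports Defs
begin

text \<open>
  Up to the factor \<open>\<epsilon>/3\<close>, \<open>bernoulli3\<close> is a quotient of the symmetric, positive integrals \<open>I2\<close> (over
  a triangle) and \<open>I3\<close> (over a tetrahedron). Multiplying the \<open>m\<close>-th equation by its \<open>I3\<close>-value \<open>E m\<close>
  leaves the vector part \<open>\<epsilon>/6\<close> times the sum of \<open>W i k = I2 (\<sigma> i) (\<sigma> k) (l i \<times> l k)\<close> over the oriented
  boundary edges of the facet \<open>F\<^sub>m\<close>. Each edge bounds two facets with opposite orientations, so the
  sum of the homogeneous equations is \<open>(\<Sum>m. |T\<^sub>m| E m) j = 0\<close>, whence \<open>j = 0\<close>. Then \<open>w = W \<cdot> \<phi>\<close> is a
  cocycle, \<open>w i k = u k - u i\<close>. With \<open>\<mu>\<close> the barycentric coordinates of \<open>x\<close>, the relation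
  \<open>\<Sum>k. \<mu> k l k = 0\<close> says that \<open>u\<close> is harmonic for nonnegative weights, and the maximum principle makes
  \<open>u\<close> constant. So \<open>\<phi>\<close> is orthogonal to all \<open>l i \<times> l k\<close>, which forces \<open>\<phi> = 0\<close>.
\<close>

section \<open>Iterated convolutions\<close>

text \<open>Convolution on the half-line. Integrals over unit simplices become iterated convolutions
  at \<open>1\<close>, so permuting exponents amounts to permuting factors.\<close>

definition conv :: "(real \<Rightarrow> real) \<Rightarrow> (real \<Rightarrow> real) \<Rightarrow> real \<Rightarrow> real" where
  "conv f g s = integral {0..s} (\<lambda>t. f t * g (s - t))"

lemma continuous_on_conv:
  assumes f: "continuous_on {0..} f" and g: "continuous_on {0..} g"
  shows "continuous_on {0..} (conv f g)"
proof -
  \<comment> \<open>The substitution \<open>t = s * u\<close> moves the integral to a fixed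
    interval, where continuity in the parameter \<open>s\<close> can be read off.\<close>
  have eq: "conv f g s = s * integral {0..1} (\<lambda>u. f (s * u) * g (s - s * u))"
    if s: "s \<in> {0..}" for s
  proof (cases "s = 0")
    case True
    then show ?thesis by (simp add: conv_def)
  next
    case False
    with s have s0: "s > 0" by simp
    have "continuous_on {0..s} (\<lambda>t. f t * g (s - t))"
      by (intro continuous_intros continuous_on_compose2[OF f] continuous_on_compose2[OF g]) auto
    then have "((\<lambda>t. f t * g (s - t)) has_integral conv f g s) (cbox 0 s)"
      unfolding conv_def cbox_interval
      using integrable_continuous_interval integrable_integral by blast
    from has_integral_affinity'[OF this s0, of 0] s0
    have "((\<lambda>u. f (s * u) * g (s - s * u)) has_integral conv f g s / s) {0..1}"
      by (simp add: divide_inverse mult.commute cbox_interval)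
    then show ?thesis using s0 by (simp add: integral_unique)
  qed
  have "continuous_on {0..} (\<lambda>s. s * integral {0..1} (\<lambda>u. f (s * u) * g (s - s * u)))"
  proof -
    have "continuous_on ({0..} \<times> cbox (0::real) 1) (\<lambda>(s, u). f (s * u) * g (s - s * u))"
      unfolding case_prod_unfold
      by (intro continuous_intros continuous_on_compose2[OF f] continuous_on_compose2[OF g])
        (auto simp: mult_left_le)
    from integral_continuous_on_param[OF this]
    show ?thesis by (intro continuous_intros) (auto simp: cbox_interval)
  qed
  then show ?thesis
    by (rule continuous_on_eq) (simp add: eq)
qed

lemma conv_nonneg:
  assumes f: "\<And>t. 0 \<le> t \<Longrightarrow> 0 \<le> f t" and g: "\<And>t. 0 \<le> t \<Longrightarrow> 0 \<le> g t"
  shows "0 \<le> conv f g s"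
proof (cases "(\<lambda>t. f t * g (s - t)) integrable_on {0..s}")
  case True
  then show ?thesis
    unfolding conv_def by (rule integral_nonneg) (simp add: f g)
next
  case False
  then show ?thesis by (simp add: conv_def not_integrable_integral)
qed

text \<open>Positivity of \<open>g\<close> is asked only away from \<open>0\<close>, because a
  convolution, which vanishes at \<open>0\<close>, takes its place when the lemma is
  iterated.\<close>

lemma conv_pos:
  assumes f: "continuous_on {0..} f" and g: "continuous_on {0..} g"
    and fpos: "\<And>t. 0 \<le> t \<Longrightarrow> 0 < f t" and gpos: "\<And>t. 0 < t \<Longrightarrow> 0 < g t"
    and s: "0 < s"
  shows "0 < conv f g s"
proof -
  have g0: "0 \<le> g t" if "0 \<le> t" for t
  proof (rule continuous_ge_on_closure[of "{0<..}" g])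
    show "continuous_on (closure {0<..}) g" using g by simp
  qed (use that gpos in \<open>auto simp: less_imp_le\<close>)
  have cont: "continuous_on {0..s} (\<lambda>t. f t * g (s - t))"
    by (intro continuous_intros continuous_on_compose2[OF f] continuous_on_compose2[OF g]) auto
  have nn: "\<And>t. t \<in> {0..s} \<Longrightarrow> 0 \<le> f t * g (s - t)"
    using fpos g0 by (simp add: less_imp_le)
  have "conv f g s \<noteq> 0"
  proof
    assume "conv f g s = 0"
    \<comment> \<open>A continuous nonnegative integrand with zero integral vanishes everywhere, in
      particular at \<open>t = 0\<close>, where it is positive.\<close>
    then have "f 0 * g (s - 0) = 0"
      using integral_eq_0_iff[OF cont s nn] s unfolding conv_def by auto
    with fpos[of 0] gpos[OF s] show False by simp
  qed
  moreover have "0 \<le> conv f g s"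
    by (intro conv_nonneg less_imp_le[OF fpos] g0)
  ultimately show ?thesis by simp
qed

text \<open>Fubini on a triangle: extended by zero, the integrand is integrable on the plane, and
  its slices are the inner interval integrals.\<close>

lemma integral_triangle_swap:
  fixes g :: "real \<Rightarrow> real \<Rightarrow> real"
  assumes g: "continuous_on {(a, b). 0 \<le> a \<and> 0 \<le> b \<and> a + b \<le> s} (\<lambda>(a, b). g a b)"
  shows "integral {0..s} (\<lambda>b. integral {0..s - b} (\<lambda>a. g a b))
       = integral {0..s} (\<lambda>a. integral {0..s - a} (\<lambda>b. g a b))"
proof -
  define S where "S = {(a, b). 0 \<le> a \<and> 0 \<le> b \<and> a + b \<le> s}"
  have "S = {p. 0 \<le> fst p} \<inter> {p. 0 \<le> snd p} \<inter> {p. fst p + snd p \<le> s}"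
    by (auto simp: S_def)
  then have "closed S"
    by (simp only:) (intro closed_Int closed_Collect_le continuous_intros)
  moreover have "S \<subseteq> cbox (0, 0) (s, s)" by (auto simp: S_def)
  ultimately have cS: "compact S"
    by (meson bounded_cbox bounded_subset compact_eq_bounded_closed)
  define h where "h a b = indicator S (a, b) * g a b" for a b
  have int: "integrable (lborel \<Otimes>\<^sub>M lborel) (\<lambda>(a, b). h a b)"
    using borel_integrable_compact[OF cS g[folded S_def]]
    by (simp add: lborel_prod h_def case_prod_unfold indicator_def if_distrib cong: if_cong)
  have slice_l: "(LBINT a. h a b) = indicator {0..s} b * integral {0..s - b} (\<lambda>a. g a b)" for b
  proof (cases "b \<in> {0..s}")
    case True
    have "continuous_on {0..s - b} ((\<lambda>(a, b). g a b) \<circ> (\<lambda>a. (a, b)))"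
      by (intro continuous_on_compose continuous_intros continuous_on_subset[OF g])
        (use True in auto)
    then have "continuous_on {0..s - b} (\<lambda>a. g a b)" by (simp add: comp_def)
    then have "(LBINT a:{0..s - b}. g a b) = integral {0..s - b} (\<lambda>a. g a b)"
      by (intro set_borel_integral_eq_integral borel_integrable_atLeastAtMost')
    moreover have "h a b = indicator {0..s - b} a *\<^sub>R g a b" for a
      using True by (auto simp: h_def S_def indicator_def)
    ultimately show ?thesis using True by (simp add: set_lebesgue_integral_def)
  next
    case False
    then have "h a b = 0" for a by (auto simp: h_def S_def indicator_def)
    with False show ?thesis by simp
  qed
  have slice_r: "(LBINT b. h a b) = indicator {0..s} a * integral {0..s - a} (\<lambda>b. g a b)" for a
  proof (cases "a \<in> {0..s}")
    case True
    have "continuous_on {0..s - a} ((\<lambda>(a, b). g a b) \<circ> (\<lambda>b. (a, b)))"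
      by (intro continuous_on_compose continuous_intros continuous_on_subset[OF g])
        (use True in auto)
    then have "continuous_on {0..s - a} (\<lambda>b. g a b)" by (simp add: comp_def)
    then have "(LBINT b:{0..s - a}. g a b) = integral {0..s - a} (\<lambda>b. g a b)"
      by (intro set_borel_integral_eq_integral borel_integrable_atLeastAtMost')
    moreover have "h a b = indicator {0..s - a} b *\<^sub>R g a b" for b
      using True by (auto simp: h_def S_def indicator_def)
    ultimately show ?thesis using True by (simp add: set_lebesgue_integral_def)
  next
    case False
    then have "h a b = 0" for b by (auto simp: h_def S_def indicator_def)
    with False show ?thesis by simp
  qed
  have "integral {0..s} (\<lambda>b. integral {0..s - b} (\<lambda>a. g a b)) = (LBINT b. LBINT a. h a b)"
  proof -
    have "integrable lborel (\<lambda>b. LBINT a. h a b)"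
      using lborel_pair.integrable_snd[OF int] .
    then have "set_integrable lborel {0..s} (\<lambda>b. integral {0..s - b} (\<lambda>a. g a b))"
      unfolding set_integrable_def slice_l by simp
    from set_borel_integral_eq_integral(2)[OF this] show ?thesis
      by (simp add: slice_l set_lebesgue_integral_def)
  qed
  also have "\<dots> = (LBINT a. LBINT b. h a b)"
    using lborel_pair.Fubini_integral[OF int] .
  also have "\<dots> = integral {0..s} (\<lambda>a. integral {0..s - a} (\<lambda>b. g a b))"
  proof -
    have "integrable lborel (\<lambda>a. LBINT b. h a b)"
      using lborel_pair.integrable_fst[OF int] .
    then have "set_integrable lborel {0..s} (\<lambda>a. integral {0..s - a} (\<lambda>b. g a b))"
      unfolding set_integrable_def slice_r by simp
    from set_borel_integral_eq_integral(2)[OF this] show ?thesis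
      by (simp add: slice_r set_lebesgue_integral_def)
  qed
  finally show ?thesis .
qed

text \<open>Both sides integrate \<open>f t * g u * h (s - t - u)\<close> over the same triangle.
  This form swaps adjacent factors of a nested convolution, and such swaps generate all
  permutations.\<close>

lemma conv_left_commute:
  assumes f: "continuous_on {0..} f" and g: "continuous_on {0..} g" and h: "continuous_on {0..} h"
  shows "conv f (conv g h) s = conv g (conv f h) s"
proof -
  have "conv f (conv g h) s
      = integral {0..s} (\<lambda>t. integral {0..s - t} (\<lambda>u. f t * g u * h (s - t - u)))"
    unfolding conv_def by (simp add: mult.assoc)
  also have "\<dots> = integral {0..s} (\<lambda>u. integral {0..s - u} (\<lambda>t. f t * g u * h (s - t - u)))"
  proof (rule integral_triangle_swap)
    show "continuous_on {(u, t). 0 \<le> u \<and> 0 \<le> t \<and> u + t \<le> s}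
        (\<lambda>(u, t). f t * g u * h (s - t - u))"
      unfolding case_prod_unfold
      by (intro continuous_intros continuous_on_compose2[OF f] continuous_on_compose2[OF g]
          continuous_on_compose2[OF h]) auto
  qed
  also have "\<dots> = conv g (conv f h) s"
    unfolding conv_def integral_mult_right[symmetric]
    by (simp add: mult.assoc mult.left_commute diff_diff_eq add.commute)
  finally show ?thesis .
qed

section \<open>The Bernoulli function\<close>

text \<open>The factor constantly 1 belongs to the remaining barycentric coordinate, whose exponent
  is 0.\<close>

definition I2 :: "real \<Rightarrow> real \<Rightarrow> real \<Rightarrow> real" where
  "I2 \<epsilon> a b = conv (\<lambda>t. exp (b * t / \<epsilon>)) (conv (\<lambda>t. exp (a * t / \<epsilon>)) (\<lambda>_. 1)) 1"

definition I3 :: "real \<Rightarrow> real \<Rightarrow> real \<Rightarrow> real \<Rightarrow> real" where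
  "I3 \<epsilon> a b c = conv (\<lambda>t. exp (c * t / \<epsilon>))
     (conv (\<lambda>t. exp (b * t / \<epsilon>)) (conv (\<lambda>t. exp (a * t / \<epsilon>)) (\<lambda>_. 1))) 1"

lemma continuous_on_exp_scaled: "continuous_on S (\<lambda>t::real. exp (a * t / \<epsilon>))"
  unfolding divide_inverse by (intro continuous_intros)

lemmas conv_exp_intros = continuous_on_exp_scaled continuous_on_conv continuous_on_const
  conv_pos exp_gt_zero zero_less_one

lemma bernoulli3_eq: "bernoulli3 \<epsilon> a b c = \<epsilon> / 3 * I2 \<epsilon> a b / I3 \<epsilon> a b c"
proof -
  have "integral {0..1 - y2} (\<lambda>y1. exp ((a * y1 + b * y2) / \<epsilon>))
      = exp (b * y2 / \<epsilon>) * integral {0..1 - y2} (\<lambda>y1. exp (a * y1 / \<epsilon>))" for y2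
  proof -
    have "exp ((a * y1 + b * y2) / \<epsilon>) = exp (b * y2 / \<epsilon>) * exp (a * y1 / \<epsilon>)" for y1
      by (simp add: add_divide_distrib exp_add)
    then show ?thesis by simp
  qed
  moreover have "integral {0..1 - y2 - y3} (\<lambda>y1. exp ((a * y1 + b * y2 + c * y3) / \<epsilon>))
      = exp (c * y3 / \<epsilon>) * (exp (b * y2 / \<epsilon>) *
          integral {0..1 - y3 - y2} (\<lambda>y1. exp (a * y1 / \<epsilon>)))" for y2 y3
  proof -
    have "exp ((a * y1 + b * y2 + c * y3) / \<epsilon>)
        = exp (c * y3 / \<epsilon>) * (exp (b * y2 / \<epsilon>) * exp (a * y1 / \<epsilon>))" for y1
      by (simp add: add_divide_distrib exp_add)
    \<comment> \<open>Subtracting \<open>y3\<close> first matches the nesting in \<open>I3\<close>,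
      whose outermost variable is \<open>y3\<close>.\<close>
    moreover have "1 - y2 - y3 = 1 - y3 - y2" by simp
    ultimately show ?thesis by (simp only: integral_mult_right)
  qed
  ultimately show ?thesis
    by (simp add: bernoulli3_def I2_def I3_def conv_def)
qed

lemma I2_commute: "I2 \<epsilon> a b = I2 \<epsilon> b a"
  unfolding I2_def by (intro conv_left_commute conv_exp_intros)

text \<open>The three Bernoulli values in one equation have cyclically permuted arguments, hence a
  common denominator. Each link of the chain swaps two adjacent factors.\<close>

lemma I3_rotate: "I3 \<epsilon> a b c = I3 \<epsilon> b c a"
proof -
  have "I3 \<epsilon> a b c = I3 \<epsilon> a c b"
    unfolding I3_def by (intro conv_left_commute conv_exp_intros)
  also have "\<dots> = I3 \<epsilon> c a b"
    unfolding I3_def by (rule arg_cong[of _ _ "\<lambda>h. conv _ h 1"], rule ext, intro conv_left_commute conv_exp_intros)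
  also have "\<dots> = I3 \<epsilon> c b a"
    unfolding I3_def by (intro conv_left_commute conv_exp_intros)
  also have "\<dots> = I3 \<epsilon> b c a"
    unfolding I3_def by (rule arg_cong[of _ _ "\<lambda>h. conv _ h 1"], rule ext, intro conv_left_commute conv_exp_intros)
  finally show ?thesis .
qed

lemma I2_pos: "0 < I2 \<epsilon> a b"
  unfolding I2_def by (intro conv_exp_intros)

lemma I3_pos: "0 < I3 \<epsilon> a b c"
  unfolding I3_def by (intro conv_exp_intros)

section \<open>Geometry of the tetrahedron\<close>

lemma atLeastAtMost_1_4: "{1..4::nat} = {1, 2, 3, 4}"
  by auto

text \<open>Four affinely independent points affinely span the space, so
  \<open>a \<bullet> y = b\<close> holds for every \<open>y\<close>, in particular at
  \<open>0\<close> and at \<open>a\<close>.\<close>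

lemma nondegenerate_tetrahedronD:
  assumes X: "nondegenerate_tetrahedron X" and a: "\<And>i. i \<in> {1..4} \<Longrightarrow> a \<bullet> X i = b"
  shows "a = 0"
proof -
  have "card (X ` {1..4}) = Suc DIM(real^3)"
    using X by (simp add: nondegenerate_tetrahedron_def card_image)
  then have "affine hull (X ` {1..4}) = UNIV"
    using X affine_independent_span_eq nondegenerate_tetrahedron_def by blast
  moreover have "affine hull (X ` {1..4}) \<subseteq> {y. a \<bullet> y = b}"
    using a by (intro hull_minimal affine_hyperplane) auto
  ultimately have "a \<bullet> 0 = b" "a \<bullet> a = b" by blast+
  then show ?thesis by simp
qed

lemma tetrahedron_barycentric:
  assumes X: "nondegenerate_tetrahedron X" and x: "x \<in> tetrahedron X"
  obtains \<mu> where "\<And>i. i \<in> {1..4} \<Longrightarrow> 0 \<le> \<mu> i" "sum \<mu> {1..4} = 1"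
    "(\<Sum>i\<in>{1..4}. \<mu> i *\<^sub>R (X i - x)) = 0"
proof -
  have inj: "inj_on X {1..4}" using X by (simp add: nondegenerate_tetrahedron_def)
  obtain u where u: "\<forall>y\<in>X ` {1..4}. 0 \<le> u y" "sum u (X ` {1..4}) = 1"
    "(\<Sum>y\<in>X ` {1..4}. u y *\<^sub>R y) = x"
    using x by (auto simp: tetrahedron_def convex_hull_finite)
  have 1: "(\<Sum>i\<in>{1..4}. u (X i)) = 1" "(\<Sum>i\<in>{1..4}. u (X i) *\<^sub>R X i) = x"
    using u(2,3) unfolding sum.reindex[OF inj] comp_def by auto
  show ?thesis
  proof (rule that[of "\<lambda>i. u (X i)"])
    show "(\<Sum>i\<in>{1..4}. u (X i) *\<^sub>R (X i - x)) = 0"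
      by (simp only: scaleR_diff_right sum_subtractf 1 flip: scaleR_sum_left) simp
  qed (use u 1 in auto)
qed

text \<open>With measure zero the set would lie in a hyperplane; the barycentric relation and
  \<open>\<mu> m > 0\<close> would then put \<open>X m\<close> there as well.\<close>

lemma measure_sub_tetrahedron_pos:
  assumes X: "nondegenerate_tetrahedron X"
    and \<mu>: "(\<Sum>i\<in>{1..4}. \<mu> i *\<^sub>R (X i - x)) = 0" and m: "m \<in> {1..4}" "\<mu> m > 0"
  shows "measure lebesgue (sub_tetrahedron X x m) > 0"
proof -
  let ?S = "sub_tetrahedron X x m"
  have mem: "x \<in> ?S" "\<And>i. i \<in> {1..4} - {m} \<Longrightarrow> X i \<in> ?S"
    unfolding sub_tetrahedron_def opposite_facet_def
    by (auto intro!: hull_inc)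
  have "interior ?S \<noteq> {}"
  proof
    assume "interior ?S = {}"
    moreover have "convex ?S" by (simp add: sub_tetrahedron_def)
    ultimately obtain a b where a: "a \<noteq> 0" "?S \<subseteq> {y. a \<bullet> y = b}"
      using empty_interior_subset_hyperplane by metis
    have o: "a \<bullet> (X i - x) = 0" if "i \<in> {1..4} - {m}" for i
      using a(2) mem that by (auto simp: inner_diff_right)
    have "0 = a \<bullet> (\<Sum>i\<in>{1..4}. \<mu> i *\<^sub>R (X i - x))" by (simp only: \<mu> inner_zero_right)
    also have "\<dots> = (\<Sum>i\<in>{1..4}. \<mu> i * (a \<bullet> (X i - x)))" by (simp add: inner_sum_right)
    also have "\<dots> = \<mu> m * (a \<bullet> (X m - x))"
      using m(1) o by (subst sum.remove[of _ m]) auto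
    finally have "a \<bullet> (X m - x) = 0" using m(2) by simp
    with o have "a \<bullet> X i = a \<bullet> x" if "i \<in> {1..4}" for i
      using that by (cases "i = m") (auto simp: inner_diff_right)
    with X have "a = 0" by (rule nondegenerate_tetrahedronD)
    with a show False by simp
  qed
  moreover have "compact ?S" "convex ?S"
    unfolding sub_tetrahedron_def opposite_facet_def
    by (simp_all add: compact_convex_hull compact_insert finite_imp_compact)
  ultimately show ?thesis
    using negligible_convex_interior negligible_iff_measure0 lmeasurable_compact
    by (metis measure_nonneg order_le_less)
qed

text \<open>Trades the normal for a determinant sign in the vertices: the cross product is a
  positive multiple of \<open>n\<close>, and \<open>X m\<close> lies strictly on the inner
  side.\<close>

lemma cross3_orientation:
  assumes X: "nondegenerate_tetrahedron X" and m: "m \<in> {1..4}"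
    and n: "outward_unit_normal (tetrahedron X) (opposite_facet X m) n"
    and pqr: "admissible_ordering X n m p q r"
  shows "cross3 (X q - X p) (X r - X p) \<bullet> (X m - X p) < 0"
proof -
  have set: "{p, q, r} = {1..4} - {m}" and pos: "cross3 (X q - X p) (X r - X p) \<bullet> n > 0"
    using pqr by (auto simp: admissible_ordering_def)
  have F: "X i \<in> opposite_facet X m" if "i \<in> {p, q, r}" for i
    using that unfolding set opposite_facet_def by (auto intro!: hull_inc)
  have n1: "n \<bullet> n = 1" using n by (simp add: outward_unit_normal_def dot_square_norm)
  have o: "n \<bullet> (X i - X p) = 0" if "i \<in> {p, q, r}" for i
    using n F that unfolding outward_unit_normal_def by blast
  have le: "n \<bullet> (X m - X p) \<le> 0"
    using n F[of p] hull_inc[OF imageI[OF m]] unfolding outward_unit_normal_def tetrahedron_def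
    by blast
  moreover have "n \<bullet> (X m - X p) \<noteq> 0"
  proof
    assume 0: "n \<bullet> (X m - X p) = 0"
    have "n \<bullet> X i = n \<bullet> X p" if "i \<in> {1..4}" for i
      using o[of i] 0 that set by (cases "i = m") (auto simp: inner_diff_right)
    with X have "n = 0" by (rule nondegenerate_tetrahedronD)
    with n1 show False by simp
  qed
  ultimately have neg: "n \<bullet> (X m - X p) < 0" by simp
  let ?c = "cross3 (X q - X p) (X r - X p)"
  \<comment> \<open>Two uses of Lagrange's identity show that \<open>?c\<close> is parallel to
    \<open>n\<close>: the first gives \<open>cross3 n ?c = 0\<close>, the second expands the double
    product with \<open>n\<close>.\<close>
  have "cross3 n ?c = (n \<bullet> (X r - X p)) *\<^sub>R (X q - X p) - (n \<bullet> (X q - X p)) *\<^sub>R (X r - X p)"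
    by (rule Lagrange)
  then have "cross3 n ?c = 0" using o by simp
  then have "cross3 n (cross3 n ?c) = 0" by (simp only: cross_zero_right)
  then have "?c = (n \<bullet> ?c) *\<^sub>R n" unfolding Lagrange[of n n] n1 by simp
  then have "?c \<bullet> (X m - X p) = (n \<bullet> ?c) * (n \<bullet> (X m - X p))"
    by (metis inner_scaleR_left)
  with pos neg show ?thesis
    by (simp add: inner_commute mult_pos_neg)
qed

section \<open>Orientation of the facets and cancellation of edges\<close>

text \<open>The facet orderings chosen here are all outward or all inward, according to the sign of the
  determinant of the tetrahedron.\<close>

definition oriented_boundary :: "(nat \<Rightarrow> nat \<Rightarrow> 'a::ab_group_add) \<Rightarrow> nat \<Rightarrow> 'a" where
  "oriented_boundary W m =
    (if m = 1 then W 2 3 + W 3 4 + W 4 2 else if m = 2 then W 1 4 + W 4 3 + W 3 1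
     else if m = 3 then W 1 2 + W 2 4 + W 4 1 else W 1 3 + W 3 2 + W 2 1)"

text \<open>The determinant sign selects the cyclic class of \<open>(p, q, r)\<close>. Rotations
  preserve the edge sum; a transposition negates it by antisymmetry.\<close>

lemma facet_edge_sum_eq_oriented_boundary:
  fixes W :: "nat \<Rightarrow> nat \<Rightarrow> 'a::real_vector" and X :: "nat \<Rightarrow> real^3"
  assumes W: "\<And>i k. W i k = - W k i" and m: "m \<in> {1..4}"
    and pqr: "{p, q, r} = {1..4} - {m}"
    and neg: "cross3 (X q - X p) (X r - X p) \<bullet> (X m - X p) < 0"
  shows "W p q + W q r + W r p =
    (if cross3 (X 3 - X 2) (X 4 - X 2) \<bullet> (X 1 - X 2) < 0 then 1 else - 1) *\<^sub>R oriented_boundary W m"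
proof -
  define v where "v i j k l = cross3 (X j - X i) (X k - X i) \<bullet> (X l - X i)" for i j k l
  \<comment> \<open>The other 23 index orderings give \<open>v 2 3 4 1\<close> up to the sign of the
    permutation.\<close>
  have v:
      "v 1 2 3 4 = - v 2 3 4 1" "v 1 2 4 3 = v 2 3 4 1" "v 1 3 2 4 = v 2 3 4 1"
      "v 1 3 4 2 = - v 2 3 4 1" "v 1 4 2 3 = - v 2 3 4 1" "v 1 4 3 2 = v 2 3 4 1"
      "v 2 1 3 4 = v 2 3 4 1" "v 2 1 4 3 = - v 2 3 4 1" "v 2 3 1 4 = - v 2 3 4 1"
      "v 2 4 1 3 = v 2 3 4 1" "v 2 4 3 1 = - v 2 3 4 1" "v 3 1 2 4 = - v 2 3 4 1"
      "v 3 1 4 2 = v 2 3 4 1" "v 3 2 1 4 = v 2 3 4 1" "v 3 2 4 1 = - v 2 3 4 1"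
      "v 3 4 1 2 = - v 2 3 4 1" "v 3 4 2 1 = v 2 3 4 1" "v 4 1 2 3 = v 2 3 4 1"
      "v 4 1 3 2 = - v 2 3 4 1" "v 4 2 1 3 = - v 2 3 4 1" "v 4 2 3 1 = v 2 3 4 1"
      "v 4 3 1 2 = v 2 3 4 1" "v 4 3 2 1 = - v 2 3 4 1"
    unfolding v_def by (simp_all add: cross3_simps)
  have "card ({1..4} - {m}) = 3" using m by simp
  with pqr have "card {p, q, r} = 3" by simp
  then have d: "p \<noteq> q" "q \<noteq> r" "p \<noteq> r" by (auto simp: card_insert_if split: if_splits)
  have mm: "m \<noteq> p" "m \<noteq> q" "m \<noteq> r" using pqr by auto
  have mem: "p \<in> {1,2,3,4}" "q \<in> {1,2,3,4}" "r \<in> {1,2,3,4}" "m \<in> {1,2,3,4}"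
    using pqr m unfolding atLeastAtMost_1_4 by blast+
  have W': "W 2 1 = - W 1 2" "W 3 1 = - W 1 3" "W 4 1 = - W 1 4"
      "W 3 2 = - W 2 3" "W 4 2 = - W 2 4" "W 4 3 = - W 3 4"
    by (rule W)+
  have cases_4: P if "a \<in> {1, 2, 3, 4}" "a = 1 \<Longrightarrow> P" "a = 2 \<Longrightarrow> P" "a = 3 \<Longrightarrow> P" "a = 4 \<Longrightarrow> P"
    for a :: nat and P
    using that by auto
  show ?thesis
    using neg d mm unfolding v_def[symmetric]
    \<comment> \<open>Coinciding indices are discarded as the splits proceed, before the final
      simplification.\<close>
    by - (rule cases_4[OF mem(4)]; rule cases_4[OF mem(1)]; (simp only: simp_thms)?;
        rule cases_4[OF mem(2)]; (simp only: simp_thms)?;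
        rule cases_4[OF mem(3)]; (simp only: simp_thms)?; simp add: oriented_boundary_def v W' del: One_nat_def)
qed

text \<open>The boundary of a boundary vanishes: every edge occurs once in each direction.\<close>

lemma sum_oriented_boundary:
  fixes W :: "nat \<Rightarrow> nat \<Rightarrow> 'a::ab_group_add"
  assumes W: "\<And>i k. W i k = - W k i"
  shows "(\<Sum>m\<in>{1..4}. oriented_boundary W m) = 0"
  unfolding atLeastAtMost_1_4
  by (simp add: oriented_boundary_def W[of 2 1] W[of 3 1] W[of 4 1] W[of 3 2] W[of 4 2] W[of 4 3] del: One_nat_def)

text \<open>A closed 1-cochain on a tetrahedron is exact. The potential \<open>w 1\<close> is read
  off from the three facets that contain vertex 1.\<close>

lemma oriented_boundary_eq_0_imp_cocycle:
  fixes w :: "nat \<Rightarrow> nat \<Rightarrow> real"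
  assumes w: "\<And>i k. w i k = - w k i"
    and 0: "\<And>m. m \<in> {1..4} \<Longrightarrow> oriented_boundary w m = 0"
    and pqr: "p \<in> {1..4}" "q \<in> {1..4}" "r \<in> {1..4}"
  shows "w p q + w q r + w r p = 0"
proof -
  have w0: "w i i = 0" for i using w[of i i] by simp
  have "w i k = w 1 k - w 1 i" if "i \<in> {1..4}" "k \<in> {1..4}" for i k
    using that 0[of 2] 0[of 3] 0[of 4] w[of 2 1] w[of 3 1] w[of 4 1] w[of 3 2] w[of 4 2] w[of 4 3]
      w0[of 1] w0[of 2] w0[of 3] w0[of 4]
    unfolding atLeastAtMost_1_4 oriented_boundary_def by (elim insertE emptyE; simp)
  from this[of p q] this[of q r] this[of r p] pqr show ?thesis by simp
qed

section \<open>Discrete maximum principle and triviality of the kernel\<close>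

text \<open>Dividing \<open>w i k\<close> by \<open>F i k\<close> leaves a triple product linear in
  \<open>l k\<close>, whose \<open>\<mu>\<close>-weighted sum over \<open>k\<close> vanishes. So the
  potential \<open>u\<close> is harmonic for the weights \<open>\<mu> k / F i k\<close>.\<close>

lemma weighted_cross_cocycle_eq_0:
  fixes l :: "'i \<Rightarrow> real^3" and F :: "'i \<Rightarrow> 'i \<Rightarrow> real"
  assumes I: "finite I" and F: "\<And>i k. 0 < F i k"
    and \<mu>: "\<And>i. i \<in> I \<Longrightarrow> 0 \<le> \<mu> i" "sum \<mu> I = 1" "(\<Sum>i\<in>I. \<mu> i *\<^sub>R l i) = 0"
    and w: "\<And>i k. w i k = F i k * (cross3 (l i) (l k) \<bullet> \<phi>)"
    and anti: "\<And>i k. w i k = - w k i"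
    and cocycle: "\<And>p q r. p \<in> I \<Longrightarrow> q \<in> I \<Longrightarrow> r \<in> I \<Longrightarrow> w p q + w q r + w r p = 0"
    and pq: "p \<in> I" "q \<in> I"
  shows "cross3 (l p) (l q) \<bullet> \<phi> = 0"
proof -
  define u where "u = w p"
  have wu: "w i k = u k - u i" if "i \<in> I" "k \<in> I" for i k
    using cocycle[of p i k] anti[of k p] that pq by (simp add: u_def)
  have harmonic: "(\<Sum>k\<in>I. \<mu> k * (u k - u i) / F i k) = 0" if i: "i \<in> I" for i
  proof -
    have "(\<Sum>k\<in>I. \<mu> k * (u k - u i) / F i k) = (\<Sum>k\<in>I. \<mu> k * (cross3 (l i) (l k) \<bullet> \<phi>))"
      using i F w by (intro sum.cong refl) (simp add: wu[symmetric] less_imp_neq[symmetric])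
    also have "\<dots> = cross3 (l i) (\<Sum>k\<in>I. \<mu> k *\<^sub>R l k) \<bullet> \<phi>"
      using bilinear_cross
      by (simp add: bilinear_def linear_sum cross_mult_right inner_sum_left)
    finally show ?thesis by (simp add: \<mu>)
  qed
  \<comment> \<open>Weights may vanish, so extremal values are compared only with the value at an
    index of positive weight; maximum and minimum both equal \<open>u s\<close>.\<close>
  obtain s where s: "s \<in> I" "0 < \<mu> s"
    using \<mu>(1,2) by (metis less_eq_real_def sum.neutral zero_neq_one)
  have max: "u s = u i" if i: "i \<in> I" and le: "\<And>k. k \<in> I \<Longrightarrow> u k \<le> u i" for i
  proof -
    have "(\<Sum>k\<in>I. \<mu> k * (u i - u k) / F i k) = - (\<Sum>k\<in>I. \<mu> k * (u k - u i) / F i k)"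
      unfolding sum_negf[symmetric] by (simp add: algebra_simps diff_divide_distrib)
    also have "\<dots> = 0" using harmonic[OF i] by simp
    finally have "\<mu> s * (u i - u s) / F i s = 0"
      using s(1) I le \<mu>(1) F
      by (subst (asm) sum_nonneg_eq_0_iff) (auto simp: less_imp_le)
    with s F[of i s] show ?thesis by simp
  qed
  have min: "u s = u i" if i: "i \<in> I" and le: "\<And>k. k \<in> I \<Longrightarrow> u i \<le> u k" for i
  proof -
    have "\<mu> s * (u s - u i) / F i s = 0"
      using harmonic[OF i] s(1) I le \<mu>(1) F
      by (subst (asm) sum_nonneg_eq_0_iff) (auto simp: less_imp_le)
    with s F[of i s] show ?thesis by simp
  qed
  have fin: "finite (u ` I)" "u ` I \<noteq> {}" using I pq by auto
  obtain a where a: "a \<in> I" "u a = Max (u ` I)" using Max_in[OF fin] by auto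
  obtain b where b: "b \<in> I" "u b = Min (u ` I)" using Min_in[OF fin] by auto
  have "Max (u ` I) = u s" using max[OF a(1)] a fin by auto
  moreover have "Min (u ` I) = u s" using min[OF b(1)] b fin by auto
  ultimately have "u k = u s" if "k \<in> I" for k
    using that fin by (metis Max_ge Min_le antisym imageI)
  then have "w p q = 0" using wu pq by simp
  with F[of p q] show ?thesis unfolding w by simp
qed

text \<open>By cyclic symmetry of the triple product, \<open>cross3 \<phi> (X p - x)\<close> is
  orthogonal to every \<open>X q - x\<close>, hence zero; the same argument then kills
  \<open>cross3 a \<phi>\<close> for every \<open>a\<close>.\<close>

lemma orthogonal_crosses_imp_0:
  assumes X: "nondegenerate_tetrahedron X"
    and 0: "\<And>p q. p \<in> {1..4} \<Longrightarrow> q \<in> {1..4} \<Longrightarrow> cross3 (X p - x) (X q - x) \<bullet> \<phi> = 0"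
  shows "\<phi> = 0"
proof -
  have eq_0: "a = 0" if "\<And>i. i \<in> {1..4} \<Longrightarrow> a \<bullet> (X i - x) = 0" for a
    using nondegenerate_tetrahedronD[OF X, of a "a \<bullet> x"] that by (simp add: inner_diff_right)
  have "cross3 \<phi> (X p - x) = 0" if p: "p \<in> {1..4}" for p
  proof (rule eq_0)
    fix q :: nat assume "q \<in> {1..4}"
    from 0[OF p this] show "cross3 \<phi> (X p - x) \<bullet> (X q - x) = 0"
      by (metis cross_triple inner_commute)
  qed
  then have "cross3 a \<phi> = 0" for a
    by (intro eq_0) (metis cross_triple inner_commute inner_zero_left)
  then show ?thesis
    by (metis cross_basis_nonzero cross_skew neg_equal_0_iff_equal)
qed

section \<open>Linear algebra and the final assembly\<close>

lemma square_system_unique_solution: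
  fixes t c :: "nat \<Rightarrow> real" and V :: "nat \<Rightarrow> real^3"
  assumes kernel: "\<And>j \<phi>. (\<And>m. m \<in> {1..4} \<Longrightarrow> t m * j + V m \<bullet> \<phi> = 0) \<Longrightarrow> j = 0 \<and> \<phi> = 0"
  shows "\<exists>!(j, \<phi>). \<forall>m\<in>{1..4}. t m * j + V m \<bullet> \<phi> = c m"
proof -
  define g where "g m z = t m * fst z + V m \<bullet> snd z" for m and z :: "real \<times> (real^3)"
  \<comment> \<open>Packing the four left-hand sides into the space of unknowns makes
    \<open>f\<close> an endomorphism, so injectivity gives surjectivity.\<close>
  define f where "f z = (g 1 z, vector [g 2 z, g 3 z, g 4 z] :: real^3)" for z :: "real \<times> (real^3)"
  have f_eq: "f z = (d 1, vector [d 2, d 3, d 4]) \<longleftrightarrow> (\<forall>m\<in>{1..4}. g m z = d m)" for z and d :: "nat \<Rightarrow> real"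
    unfolding f_def atLeastAtMost_1_4 by (simp add: vec_eq_iff forall_3)
  have "linear f"
    by (rule linearI)
      (simp_all add: f_def g_def vec_eq_iff forall_3 algebra_simps inner_add_right)
  moreover have "inj f"
    unfolding linear_injective_0[OF \<open>linear f\<close>]
  proof (intro allI impI)
    fix z assume "f z = 0"
    then have "f z = (0, vector [0, 0, 0])"
      by (simp add: zero_prod_def vec_eq_iff forall_3)
    then show "z = 0"
      using f_eq[of z "\<lambda>_. 0"] kernel[of "fst z" "snd z"]
      by (simp add: g_def prod_eq_iff)
  qed
  ultimately have "bij f"
    by (intro bijI linear_injective_imp_surjective[OF _ _ refl])
  then have "\<exists>!z. f z = (c 1, vector [c 2, c 3, c 4])"
    by (simp add: bij_iff)
  then show ?thesis
    unfolding f_eq[of _ c] g_def case_prod_unfold .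
qed

theorem lemma4p1:
  fixes X :: "nat \<Rightarrow> real^3" and \<epsilon> :: real and \<beta> :: "real^3 \<Rightarrow> real^3"
    and n :: "nat \<Rightarrow> real^3" and p q r :: "nat \<Rightarrow> nat" and x :: "real^3"
  assumes "nondegenerate_tetrahedron X"
    and "\<epsilon> > 0"
    and "\<And>m. m \<in> {1..4} \<Longrightarrow> outward_unit_normal (tetrahedron X) (opposite_facet X m) (n m)"
    and "\<And>m. m \<in> {1..4} \<Longrightarrow> admissible_ordering X (n m) m (p m) (q m) (r m)"
    and "x \<in> tetrahedron X"
  shows
    "let l = (\<lambda>i. X i - x);
         \<sigma> = (\<lambda>i. \<beta> x \<bullet> l i);
         \<sigma>2 = (\<lambda>i k. \<beta> x \<bullet> (X k - X i));
         B = bernoulli3 \<epsilon>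
     in \<exists>!(j :: real, \<phi> :: real^3). \<forall>m\<in>{1..4}.
          measure lebesgue (sub_tetrahedron X x m) * j
          + (B (\<sigma> (p m)) (\<sigma> (q m)) (\<sigma> (r m)) *\<^sub>R (cross3 (l (p m)) (l (q m)) /\<^sub>R 2)
             + B (\<sigma> (q m)) (\<sigma> (r m)) (\<sigma> (p m)) *\<^sub>R (cross3 (l (q m)) (l (r m)) /\<^sub>R 2)
             + B (\<sigma> (r m)) (\<sigma> (p m)) (\<sigma> (q m)) *\<^sub>R (cross3 (l (r m)) (l (p m)) /\<^sub>R 2)) \<bullet> \<phi>
          = B (\<sigma>2 (p m) (q m)) (\<sigma>2 (p m) (r m)) (- \<sigma> (p m)) * (if m = 1 then 1 else 0)"
proof -
  define l where "l i = X i - x" for i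
  define \<sigma> where "\<sigma> i = \<beta> x \<bullet> l i" for i
  define W where "W i k = I2 \<epsilon> (\<sigma> i) (\<sigma> k) *\<^sub>R cross3 (l i) (l k)" for i k
  define E where "E m = I3 \<epsilon> (\<sigma> (p m)) (\<sigma> (q m)) (\<sigma> (r m))" for m
  define vol where "vol m = measure lebesgue (sub_tetrahedron X x m)" for m
  define V where "V m = bernoulli3 \<epsilon> (\<sigma> (p m)) (\<sigma> (q m)) (\<sigma> (r m)) *\<^sub>R (cross3 (l (p m)) (l (q m)) /\<^sub>R 2)
    + bernoulli3 \<epsilon> (\<sigma> (q m)) (\<sigma> (r m)) (\<sigma> (p m)) *\<^sub>R (cross3 (l (q m)) (l (r m)) /\<^sub>R 2)
    + bernoulli3 \<epsilon> (\<sigma> (r m)) (\<sigma> (p m)) (\<sigma> (q m)) *\<^sub>R (cross3 (l (r m)) (l (p m)) /\<^sub>R 2)" for m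
  define s :: real where
    "s = (if cross3 (X 3 - X 2) (X 4 - X 2) \<bullet> (X 1 - X 2) < 0 then 1 else - 1)"
  have W: "W i k = - W k i" for i k
    unfolding W_def using cross_skew[of "l i" "l k"] by (simp add: I2_commute[of \<epsilon> "\<sigma> i"])
  have E_pos: "0 < E m" for m unfolding E_def by (rule I3_pos)
  have V: "E m *\<^sub>R V m = (\<epsilon> / 6 * s) *\<^sub>R oriented_boundary W m" if m: "m \<in> {1..4}" for m
  proof -
    \<comment> \<open>By cyclic symmetry all three quotients have denominator \<open>E m\<close>.
      The factor \<open>\<epsilon> / 6\<close> joins the \<open>\<epsilon> / 3\<close> of
      \<open>bernoulli3_eq\<close> to the halved cross products.\<close>
    have "E m = I3 \<epsilon> (\<sigma> (q m)) (\<sigma> (r m)) (\<sigma> (p m))" "E m = I3 \<epsilon> (\<sigma> (r m)) (\<sigma> (p m)) (\<sigma> (q m))"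
      unfolding E_def by (metis I3_rotate)+
    then have "E m *\<^sub>R V m = (\<epsilon> / 6) *\<^sub>R (W (p m) (q m) + W (q m) (r m) + W (r m) (p m))"
      using E_pos[of m] unfolding V_def W_def bernoulli3_eq E_def[symmetric]
      by (simp add: scaleR_add_right)
    also have "\<dots> = (\<epsilon> / 6) *\<^sub>R (s *\<^sub>R oriented_boundary W m)"
      unfolding s_def
      using facet_edge_sum_eq_oriented_boundary[of W, OF W m _ cross3_orientation[OF assms(1) m assms(3,4)[OF m]]]
        assms(4)[OF m] by (simp only: admissible_ordering_def)
    finally show ?thesis by simp
  qed
  obtain \<mu> where \<mu>: "\<And>i. i \<in> {1..4} \<Longrightarrow> 0 \<le> \<mu> i" "sum \<mu> {1..4} = 1"
    "(\<Sum>i\<in>{1..4}. \<mu> i *\<^sub>R (X i - x)) = 0"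
    by (rule tetrahedron_barycentric[OF assms(1,5)]) blast
  \<comment> \<open>Some vertex has positive barycentric weight, so its sub-tetrahedron has positive
    volume; the others may be degenerate.\<close>
  have vol_pos: "0 < (\<Sum>m\<in>{1..4}. vol m * E m)"
  proof -
    obtain k where k: "k \<in> {1..4}" "0 < \<mu> k"
      using \<mu>(1,2) by (metis less_eq_real_def sum.neutral zero_neq_one)
    then have "0 < vol k"
      unfolding vol_def by (rule measure_sub_tetrahedron_pos[OF assms(1) \<mu>(3)])
    with k E_pos show ?thesis
      by (intro sum_pos2[of _ k]) (auto simp: vol_def less_imp_le)
  qed
  have "\<exists>!(j, \<phi>). \<forall>m\<in>{1..4}. vol m * j + V m \<bullet> \<phi> =
      bernoulli3 \<epsilon> (\<beta> x \<bullet> (X (q m) - X (p m))) (\<beta> x \<bullet> (X (r m) - X (p m))) (- \<sigma> (p m)) * (if m = 1 then 1 else 0)"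
  proof (rule square_system_unique_solution)
    fix j :: real and \<phi> :: "real^3"
    assume ker: "\<And>m. m \<in> {1..4} \<Longrightarrow> vol m * j + V m \<bullet> \<phi> = 0"
    have row: "vol m * E m * j + \<epsilon> / 6 * s * (oriented_boundary W m \<bullet> \<phi>) = 0"
      if m: "m \<in> {1..4}" for m
    proof -
      have "vol m * E m * j + (E m *\<^sub>R V m) \<bullet> \<phi> = E m * (vol m * j + V m \<bullet> \<phi>)"
        by (simp add: algebra_simps)
      then show ?thesis using ker[OF m] V[OF m] by simp
    qed
    \<comment> \<open>Summing the scaled rows cancels all edge terms and isolates \<open>j\<close>
      with a positive coefficient.\<close>
    have "(\<Sum>m\<in>{1..4}. vol m * E m * j + \<epsilon> / 6 * s * (oriented_boundary W m \<bullet> \<phi>)) = 0"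
      by (rule sum.neutral) (use row in blast)
    then have "(\<Sum>m\<in>{1..4}. vol m * E m) * j + \<epsilon> / 6 * s * ((\<Sum>m\<in>{1..4}. oriented_boundary W m) \<bullet> \<phi>) = 0"
      by (simp only: sum.distrib inner_sum_left sum_distrib_left sum_distrib_right)
    then have j: "j = 0"
      using vol_pos unfolding sum_oriented_boundary[OF W] by simp
    define w where "w i k = W i k \<bullet> \<phi>" for i k
    have anti: "w i k = - w k i" for i k
      unfolding w_def by (subst W) simp
    have "oriented_boundary w m = 0" if m: "m \<in> {1..4}" for m
    proof -
      have "oriented_boundary w m = oriented_boundary W m \<bullet> \<phi>"
        by (simp add: oriented_boundary_def w_def inner_add_left)
      \<comment> \<open>With \<open>j = 0\<close>, the nonzero factor
        \<open>\<epsilon> / 6 * s\<close> is cancelled from the row.\<close>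
      then show ?thesis using row[OF m] j assms(2) by (simp add: s_def split: if_splits)
    qed
    then have cocycle: "w p q + w q r + w r p = 0"
      if "p \<in> {1..4}" "q \<in> {1..4}" "r \<in> {1..4}" for p q r
      by (intro oriented_boundary_eq_0_imp_cocycle anti that)
    have "cross3 (X p - x) (X q - x) \<bullet> \<phi> = 0" if pq: "p \<in> {1..4}" "q \<in> {1..4}" for p q
    proof (rule weighted_cross_cocycle_eq_0[OF _ I2_pos \<mu> _ anti cocycle pq])
      show "w i k = I2 \<epsilon> (\<sigma> i) (\<sigma> k) * (cross3 (X i - x) (X k - x) \<bullet> \<phi>)" for i k
        by (simp only: w_def W_def l_def inner_scaleR_left)
    qed simp_all
    then have "\<phi> = 0"
      by (rule orthogonal_crosses_imp_0[OF assms(1)])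
    with j show "j = 0 \<and> \<phi> = 0" ..
  qed
  then show ?thesis
    unfolding Let_def vol_def V_def \<sigma>_def l_def .
qed

end
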